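(* For any real $c>0$ and any $n,t\in\mathbb N_0$, $$J_{2n}^{2c}(t)=\sum_{k=0}^{\lfloor t/2\rfloor}(-1)^{k+n}(2c^2)^k\binom{t}{2k}I_n^1(k).$$
   Context: Discrete Bessel functions: for $t,n\in\mathbb N_0$ with $n\le t$ and $c\in\mathbb C$, $$I^{c}_{n}(t)=\sum_{\ell=0}^{\lfloor (t-n)/2\rfloor}\frac{t!}{\ell!\,(t-2\ell-n)!\,(n+\ell)!}\left(\frac c2\right)^{2\ell+n},\qquad J^{c}_{n}(t)=\sum_{\ell=0}^{\lfloor (t-n)/2\rfloor}\frac{(-1)^\ell\,t!}{\ell!\,(t-2\ell-n)!\,(n+\ell)!}\left(\frac c2\right)^{2\ell+n},$$ and $I_n^c(t)=J_n^c(t)=0$ if $n>t$. *)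

theory Defs
  imports Complex_Main
begin

definition discrete_bessel_I :: "complex \<Rightarrow> nat \<Rightarrow> nat \<Rightarrow> complex" where
  "discrete_bessel_I c n t =
     (if n \<le> t
      then (\<Sum>l = 0..(t - n) div 2.
              fact t / (fact l * fact (t - 2 * l - n) * fact (n + l)) * (c / 2) ^ (2 * l + n))
      else 0)"

definition discrete_bessel_J :: "complex \<Rightarrow> nat \<Rightarrow> nat \<Rightarrow> complex" where
  "discrete_bessel_J c n t =
     (if n \<le> t
      then (\<Sum>l = 0..(t - n) div 2.
              (- 1) ^ l * fact t / (fact l * fact (t - 2 * l - n) * fact (n + l)) * (c / 2) ^ (2 * l + n))
      else 0)"

end

theory Submission
  imports Defs "HOL-Computational_Algebra.Polynomial"
begin

text \<open>
  Both sides are sums over \<open>k\<close> that agree term by term; the terms with \<open>k < n\<close> vanish, because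
  \<open>I\<close> does. Put \<open>k = l + n\<close> in the sum
  defining \<open>J\<close>: since \<open>2 n + l = k + n\<close>, the factorials regroup into
  \<open>(t choose 2 k) * (2 k choose (k - n))\<close>, and the power of \<open>c\<close> becomes \<open>c ^ (2 k)\<close>
  (lemma \<open>discrete_bessel_J_even\<close>). It remains to see that \<open>2 ^ k * I\<close>, taken at parameter
  \<open>1\<close>, is \<open>2 k choose (k - n)\<close> (lemma \<open>discrete_bessel_I_one\<close>). Multiplied by \<open>2 ^ k\<close>, the
  defining sum of \<open>I\<close> collects the trinomial terms that contribute to the coefficient of
  \<open>x ^ n\<close> in \<open>(x + 2 + 1 / x) ^ k\<close>, and this Laurent polynomial is \<open>(1 + x) ^ (2 k) / x ^ k\<close>.
\<close>

lemma coeff_linear_poly_power_one: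
  fixes b :: "'a :: comm_semiring_1"
  shows "coeff ([:1, b:] ^ n) i = of_nat (n choose i) * b ^ i"
proof (cases "i \<le> n")
  case True
  then show ?thesis by (simp add: coeff_linear_poly_power)
next
  case False
  have "degree ([:1, b:] ^ n) \<le> 1 * n"
    by (rule order_trans[OF degree_power_le]) (simp add: mult_le_mono)
  with False show ?thesis by (simp add: coeff_eq_0 binomial_eq_0)
qed

text \<open>
  Compare the coefficients of \<open>x ^ m\<close> in \<open>(1 + x) ^ (2 k) = (x ^ 2 + (1 + 2 x)) ^ k\<close>, expanding
  the right-hand side by the binomial theorem twice.
\<close>
lemma choose_double_trinomial_sum:
  fixes k m :: nat
  shows "(2 * k) choose m =
    (\<Sum>l\<le>m div 2. (k choose l) * ((k - l) choose (m - 2 * l)) * 2 ^ (m - 2 * l))"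
proof -
  have square: "[:1, 1:] ^ 2 = monom 1 2 + [:1, 2 :: nat:]"
    by (simp add: power2_eq_square monom_altdef)
  have expand: "[:1, 1 :: nat:] ^ (2 * k) =
      (\<Sum>l\<le>k. smult (k choose l) (monom 1 (2 * l) * [:1, 2:] ^ (k - l)))"
    unfolding power_mult square binomial_ring
    by (simp add: monom_power of_nat_poly mult.assoc)
  have "(2 * k) choose m = coeff ([:1, 1 :: nat:] ^ (2 * k)) m"
    by (simp add: coeff_linear_poly_power_one del: One_nat_def)
  also have "\<dots> = (\<Sum>l\<le>k. (k choose l) *
      (if 2 * l \<le> m then ((k - l) choose (m - 2 * l)) * 2 ^ (m - 2 * l) else 0))"
    unfolding expand coeff_sum
    by (intro sum.cong refl) (simp add: coeff_monom_mult coeff_linear_poly_power_one del: One_nat_def)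
  also have "\<dots> = (\<Sum>l\<le>m div 2. (k choose l) * ((k - l) choose (m - 2 * l)) * 2 ^ (m - 2 * l))"
    by (rule sum.mono_neutral_cong) (auto simp: not_le)
  finally show ?thesis .
qed

lemma discrete_bessel_I_one:
  fixes n k :: nat
  assumes "n \<le> k"
  shows "2 ^ k * discrete_bessel_I 1 n k = of_nat ((2 * k) choose (k - n))"
proof -
  have term_eq: "2 ^ k * (fact k / (fact l * fact (k - 2 * l - n) * fact (n + l)) *
        (1 / 2) ^ (2 * l + n)) =
      (of_nat ((k choose l) * ((k - l) choose (k - n - 2 * l)) * 2 ^ (k - n - 2 * l)) :: complex)"
    if "l \<le> (k - n) div 2" for l
  proof -
    define r where "r = k - 2 * l - n"
    then have r: "k = r + 2 * l + n"
      using that assms by arith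
    have "of_nat (k choose l) * of_nat ((k - l) choose r) =
        (fact k / (fact l * fact r * fact (n + l)) :: complex)"
      by (simp add: r binomial_fact add.commute)
    then show ?thesis
      by (simp add: r power_add power_divide mult_ac)
  qed
  have "2 ^ k * discrete_bessel_I 1 n k =
      (\<Sum>l\<le>(k - n) div 2.
        of_nat ((k choose l) * ((k - l) choose (k - n - 2 * l)) * 2 ^ (k - n - 2 * l)))"
    unfolding discrete_bessel_I_def sum_distrib_left atLeast0AtMost
    using assms by (simp only: if_True sum_distrib_left) (intro sum.cong refl term_eq, simp)
  also have "\<dots> = of_nat ((2 * k) choose (k - n))"
    by (simp only: choose_double_trinomial_sum[of k "k - n"] of_nat_sum)
  finally show ?thesis .
qed

lemma discrete_bessel_J_even:
  fixes c :: complex and n t :: nat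
  shows "discrete_bessel_J (2 * c) (2 * n) t =
    (\<Sum>k = n..t div 2. (- 1) ^ (k + n) * c ^ (2 * k) *
       of_nat (t choose (2 * k)) * of_nat ((2 * k) choose (k - n)))"
proof (cases "2 * n \<le> t")
  case False
  then show ?thesis by (simp add: discrete_bessel_J_def)
next
  case True
  have "discrete_bessel_J (2 * c) (2 * n) t =
      (\<Sum>l = 0..t div 2 - n.
        (- 1) ^ l * fact t / (fact l * fact (t - 2 * l - 2 * n) * fact (2 * n + l)) *
        c ^ (2 * l + 2 * n))"
  proof -
    have "(t - 2 * n) div 2 = t div 2 - n" by simp
    with True show ?thesis by (simp add: discrete_bessel_J_def)
  qed
  also have "\<dots> = (\<Sum>l = 0..t div 2 - n. (- 1) ^ (l + n + n) * c ^ (2 * (l + n)) *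
       of_nat (t choose (2 * (l + n))) * of_nat ((2 * (l + n)) choose (l + n - n)))"
  proof (intro sum.cong refl)
    fix l assume "l \<in> {0..t div 2 - n}"
    with True have le: "2 * (l + n) \<le> t" by auto
    have "2 * (l + n) - l = 2 * n + l" by simp
    then have "of_nat (t choose (2 * (l + n))) * of_nat ((2 * (l + n)) choose l) =
        (fact t / (fact l * fact (t - 2 * l - 2 * n) * fact (2 * n + l)) :: complex)"
      using le by (simp add: binomial_fact add.commute)
    moreover have "(- 1) ^ (l + n + n) = ((- 1) ^ l :: complex)"
      by (simp add: power_add flip: power_mult_distrib)
    ultimately show "(- 1) ^ l * fact t /
          (fact l * fact (t - 2 * l - 2 * n) * fact (2 * n + l)) * c ^ (2 * l + 2 * n) =
        (- 1) ^ (l + n + n) * c ^ (2 * (l + n)) *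
          of_nat (t choose (2 * (l + n))) * of_nat ((2 * (l + n)) choose (l + n - n))"
      by (simp add: mult_ac)
  qed
  also have "\<dots> = (\<Sum>k = n..t div 2. (- 1) ^ (k + n) * c ^ (2 * k) *
       of_nat (t choose (2 * k)) * of_nat ((2 * k) choose (k - n)))"
    using sum.shift_bounds_cl_nat_ivl[of "\<lambda>k. (- 1) ^ (k + n) * c ^ (2 * k) *
       of_nat (t choose (2 * k)) * of_nat ((2 * k) choose (k - n))" 0 n "t div 2 - n"] True
    by simp
  finally show ?thesis .
qed

theorem corollary5p4:
  fixes c :: real and n t :: nat
  assumes "c > 0"
  shows "discrete_bessel_J (2 * complex_of_real c) (2 * n) t =
    (\<Sum>k = 0..t div 2. (- 1) ^ (k + n) * (2 * (complex_of_real c)\<^sup>2) ^ k *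
       of_nat (t choose (2 * k)) * discrete_bessel_I 1 n k)"
  unfolding discrete_bessel_J_even
proof (rule sum.mono_neutral_cong_left)
  show "\<forall>k \<in> {0..t div 2} - {n..t div 2}.
      (- 1) ^ (k + n) * (2 * (complex_of_real c)\<^sup>2) ^ k *
        of_nat (t choose (2 * k)) * discrete_bessel_I 1 n k = 0"
    by (auto simp: discrete_bessel_I_def)
next
  fix k assume "k \<in> {n..t div 2}"
  then have "of_nat ((2 * k) choose (k - n)) = 2 ^ k * discrete_bessel_I 1 n k"
    by (simp add: discrete_bessel_I_one)
  then show "(- 1) ^ (k + n) * complex_of_real c ^ (2 * k) *
        of_nat (t choose (2 * k)) * of_nat ((2 * k) choose (k - n)) =
      (- 1) ^ (k + n) * (2 * (complex_of_real c)\<^sup>2) ^ k *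
        of_nat (t choose (2 * k)) * discrete_bessel_I 1 n k"
    by (simp add: power_mult_distrib mult_ac flip: power_mult)
qed auto

end
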